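(* Let $w_0\in\mathcal{S}_{n+1}$ be the order-reversing permutation $w_0(i)=n+2-i$ and $Inv(\mathcal{S}_{n+1})=\{\sigma\in\mathcal{S}_{n+1}:\sigma^2=e\}$. The $n$-dimensional Poincaré algorithm $(\Delta,T)$ is algebraic self-dual on $w_0Inv(\mathcal{S}_{n+1})=\{w_0\tau:\tau\in Inv(\mathcal{S}_{n+1})\}$, with intertwining map $\phi$ the fractional linear map associated with the $(n+1)\times(n+1)$ matrix $$A_\phi=\left(\begin{array}{ccc}1&\cdots&1\\ \vdots&\cdot^{\cdot^{\cdot}}&\\ 1&&\end{array}\right),$$ i.e. (rows and columns indexed $0,\dots,n$) $(A_\phi)_{ij}=1$ if $i+j\le n$ and $0$ otherwise. That is, $\phi:\Delta^{\#}\to\Delta$ is a bijective, differentiable and measurable map, $\phi\circ T^{\#}=T\circ\phi$ on $\Delta^{\#}$, and $\phi(\mathring{\Delta^{\#}(\sigma)})=\mathring{\Delta(\sigma)}$ for every $\sigma\in w_0Inv(\mathcal{S}_{n+1})$.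
   Context: For an invertible matrix $A=(A_{ij})_{0\le i,j\le n}$ the associated fractional linear map is $x\mapsto y$ with $y_i=\dfrac{A_{i0}+\sum_{j=1}^nA_{ij}x_j}{A_{00}+\sum_{j=1}^nA_{0j}x_j}$, $1\le i\le n$. The symbol $\mathring{\ }$ denotes interior in $\mathbb{R}^n$; $\mathcal{S}_{n+1}$ is the symmetric group on $\{1,\dots,n+1\}$ with identity $e$. Poincaré algorithm: $\Delta=\{x\in\mathbb{R}^n:1\ge x_1\ge\cdots\ge x_n\ge0\}$. For $x\in\Delta$ put $x_0=1$, $x'_m=x_{m-1}-x_m$ for $1\le m\le n$, and $x'_{n+1}=x_n$. For a digit $\sigma\in\mathcal{S}_{n+1}$, $$\Delta(\sigma)=\{x\in\Delta:x'_{\sigma^{-1}(1)}>x'_{\sigma^{-1}(2)}>\cdots>x'_{\sigma^{-1}(n+1)}\},$$ and on $\Delta(\sigma)$ $$T(x)=\left(\frac{x'_{\sigma^{-1}(2)}}{x'_{\sigma^{-1}(1)}},\dots,\frac{x'_{\sigma^{-1}(n+1)}}{x'_{\sigma^{-1}(1)}}\right).$$ Dual algorithm (given on each piece by the transposed matrices of $T$): $\Delta^{\#}=\{x\in\mathbb{R}^n:x_i>0\ \forall i\}$; with $x_0=1$, $$\Delta^{\#}(\sigma)=\{x\in\Delta^{\#}:x_{\sigma(i+1)-1}-x_{\sigma(i)-1}>0\ \text{for }i=1,\dots,n\},$$ and on $\Delta^{\#}(\sigma)$ the $i$-th coordinate of $T^{\#}(x)$ is $\dfrac{x_{\sigma(i+1)-1}-x_{\sigma(i)-1}}{x_{\sigma(1)-1}}$,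 $1\le i\le n$. Algebraic self-dual on a set $\mathcal{D}$ of digits means: there is a bijective, differentiable and measurable map $\phi:\Delta^{\#}\to\Delta$ such that $\phi\circ T^{\#}=T\circ\phi$ (the whole diagram commutes, not only on pieces with digit in $\mathcal{D}$) and $\phi(\mathring{\Delta^{\#}(\sigma)})=\mathring{\Delta(\sigma)}$ for all $\sigma\in\mathcal{D}$.
   Formalization: Bijectivity of φ is stated from Δ^# onto the interior of Δ, with Δ minus its interior Lebesgue-null: onto the closed simplex Δ it fails, since the last coordinate of φ(x) is 1/(1+x_1+…+x_n) > 0, so the origin is never attained. *)

theory Defs
  imports "HOL-Analysis.Analysis" "HOL-Combinatorics.Permutations"
begin

(* Points of R^n are vectors x :: real ^ 'n with n = CARD('n) over a linearly ordered finite
   index type; ix i in {1..n} is the position of the index i in that order. *)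

definition ix :: "'n::{finite,linorder} \<Rightarrow> nat" where
  "ix i = card {j. j \<le> i}"

lemma ix_strict_mono: "i < j \<Longrightarrow> ix i < ix (j :: 'n::{finite,linorder})"
proof -
  assume "i < j"
  then have "{k. k \<le> i} \<subset> {k. k \<le> j}"
    by (auto simp: psubset_eq set_eq_iff) (meson leD order_refl)
  then show ?thesis
    unfolding ix_def by (intro psubset_card_mono) auto
qed

lemma bij_betw_ix: "bij_betw (ix :: 'n::{finite,linorder} \<Rightarrow> nat) UNIV {1..CARD('n)}"
proof -
  have inj: "inj (ix :: 'n \<Rightarrow> nat)"
    by (rule injI) (metis ix_strict_mono less_irrefl neqE)
  have "1 \<le> ix i \<and> ix i \<le> CARD('n)" for i :: 'n
  proof -
    have "ix i \<noteq> 0"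
      unfolding ix_def by auto
    moreover have "ix i \<le> CARD('n)"
      unfolding ix_def by (rule card_mono) auto
    ultimately show ?thesis by simp
  qed
  then have sub: "range (ix :: 'n \<Rightarrow> nat) \<subseteq> {1..CARD('n)}"
    by auto
  have "range (ix :: 'n \<Rightarrow> nat) = {1..CARD('n)}"
    by (rule card_subset_eq) (use sub inj in \<open>auto simp: card_image\<close>)
  with inj show ?thesis
    by (simp add: bij_betw_def)
qed

(* x_0 = 1 and x_m for 1 <= m <= n *)
definition crd :: "real ^ ('n::{finite,linorder}) \<Rightarrow> nat \<Rightarrow> real" where
  "crd x m = (if m = 0 then 1 else x $ the_inv ix m)"

lemma crd_ix [simp]: "crd x (ix i) = x $ i"
proof -
  have "inj (ix :: 'a \<Rightarrow> nat)"
    using bij_betw_ix by (rule bij_betw_imp_inj_on)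
  moreover have "ix i \<noteq> 0"
    unfolding ix_def by auto
  ultimately show ?thesis
    by (simp add: crd_def the_inv_f_f)
qed

section \<open>Fractional linear maps\<close>

(* Matrix rows and columns 0, ..., n are indexed by 'n option: None is index 0, and
   Some i is index ix i. *)

definition ix0 :: "'n::{finite,linorder} option \<Rightarrow> nat" where
  "ix0 r = (case r of None \<Rightarrow> 0 | Some i \<Rightarrow> ix i)"

definition frac_lin :: "real ^ 'n option ^ 'n option \<Rightarrow> real ^ 'n \<Rightarrow> real ^ 'n::finite" where
  "frac_lin A x = (\<chi> i. (A $ Some i $ None + (\<Sum>j\<in>UNIV. A $ Some i $ Some j * x $ j))
                      / (A $ None $ None + (\<Sum>j\<in>UNIV. A $ None $ Some j * x $ j)))"

definition A_phi :: "real ^ ('n::{finite,linorder}) option ^ ('n::{finite,linorder}) option" where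
  "A_phi = (\<chi> r c. if ix0 r + ix0 c \<le> CARD('n) then 1 else 0)"

section \<open>Digits\<close>

definition digits :: "nat \<Rightarrow> (nat \<Rightarrow> nat) set" where
  "digits n = {\<sigma>. \<sigma> permutes {1..n+1}}"

definition w0 :: "nat \<Rightarrow> nat \<Rightarrow> nat" where
  "w0 n i = (if i \<in> {1..n+1} then n + 2 - i else i)"

definition Inv_digits :: "nat \<Rightarrow> (nat \<Rightarrow> nat) set" where
  "Inv_digits n = {\<sigma> \<in> digits n. \<sigma> \<circ> \<sigma> = id}"

section \<open>The Poincare algorithm\<close>

(* the differences x'_m, 1 <= m <= n+1 *)
definition pdiff :: "real ^ ('n::{finite,linorder}) \<Rightarrow> nat \<Rightarrow> real" where
  "pdiff x m = (if m \<le> CARD('n) then crd x (m - 1) - crd x m else crd x (CARD('n)))"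

definition Delta :: "(real ^ ('n::{finite,linorder})) set" where
  "Delta = {x. (\<forall>m\<in>{1..CARD('n)}. crd x m \<le> crd x (m - 1)) \<and> 0 \<le> crd x (CARD('n))}"

definition Delta_piece :: "(nat \<Rightarrow> nat) \<Rightarrow> (real ^ ('n::{finite,linorder})) set" where
  "Delta_piece \<sigma> =
     {x \<in> Delta. \<forall>i\<in>{1..CARD('n)}. pdiff x (inv \<sigma> i) > pdiff x (inv \<sigma> (i + 1))}"

definition T_branch ::
  "(nat \<Rightarrow> nat) \<Rightarrow> real ^ ('n::{finite,linorder}) \<Rightarrow> real ^ ('n::{finite,linorder})" where
  "T_branch \<sigma> x = (\<chi> i. pdiff x (inv \<sigma> (ix i + 1)) / pdiff x (inv \<sigma> 1))"

(* T is a partial map: it is undefined where two of the x'_m coincide. The digit of a point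
   is unique, see poincare_T_eq below. *)
definition poincare_T :: "real ^ ('n::{finite,linorder}) \<Rightarrow> (real ^ ('n::{finite,linorder})) option" where
  "poincare_T x =
     (if \<exists>\<sigma>\<in>digits CARD('n). x \<in> Delta_piece \<sigma>
      then Some (T_branch (THE \<sigma>. \<sigma> \<in> digits CARD('n) \<and> x \<in> Delta_piece \<sigma>) x)
      else None)"

section \<open>The dual algorithm\<close>

definition dual_Delta :: "(real ^ ('n::{finite,linorder})) set" where
  "dual_Delta = {x. \<forall>i. x $ i > 0}"

definition dual_Delta_piece :: "(nat \<Rightarrow> nat) \<Rightarrow> (real ^ ('n::{finite,linorder})) set" where
  "dual_Delta_piece \<sigma> =
     {x \<in> dual_Delta. \<forall>i\<in>{1..CARD('n)}. crd x (\<sigma> (i + 1) - 1) - crd x (\<sigma> i - 1) > 0}"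

definition dual_T_branch ::
  "(nat \<Rightarrow> nat) \<Rightarrow> real ^ ('n::{finite,linorder}) \<Rightarrow> real ^ ('n::{finite,linorder})" where
  "dual_T_branch \<sigma> x =
     (\<chi> i. (crd x (\<sigma> (ix i + 1) - 1) - crd x (\<sigma> (ix i) - 1)) / crd x (\<sigma> 1 - 1))"

definition dual_T :: "real ^ ('n::{finite,linorder}) \<Rightarrow> (real ^ ('n::{finite,linorder})) option" where
  "dual_T x =
     (if \<exists>\<sigma>\<in>digits CARD('n). x \<in> dual_Delta_piece \<sigma>
      then Some (dual_T_branch (THE \<sigma>. \<sigma> \<in> digits CARD('n) \<and> x \<in> dual_Delta_piece \<sigma>) x)
      else None)"

section \<open>Uniqueness of the digit\<close>

lemma strict_enumeration_unique:
  fixes f :: "nat \<Rightarrow> real"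
  assumes p: "p permutes {1..n+1}" and q: "q permutes {1..n+1}"
    and fp: "\<And>i. i \<in> {1..n} \<Longrightarrow> f (p i) < f (p (i + 1))"
    and fq: "\<And>i. i \<in> {1..n} \<Longrightarrow> f (q i) < f (q (i + 1))"
  shows "p = q"
proof -
  have mono: "f (r i) < f (r j)"
    if "\<And>i. i \<in> {1..n} \<Longrightarrow> f (r i) < f (r (i + 1))" "1 \<le> i" "i < j" "j \<le> n + 1"
    for r :: "nat \<Rightarrow> nat" and i j
    using that(3,4)
  proof (induction j)
    case 0
    then show ?case by simp
  next
    case (Suc k)
    have "f (r k) < f (r (k + 1))"
      using Suc.prems that(2) by (intro that(1)) auto
    then show ?case
      using Suc by (cases "i = k") auto
  qed
  define P where "P = map (f \<circ> p) [1..<n+2]"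
  define Q where "Q = map (f \<circ> q) [1..<n+2]"
  have len: "length P = n + 1" "length Q = n + 1"
    by (simp_all add: P_def Q_def)
  have sP: "sorted_wrt (<) P"
    unfolding P_def sorted_wrt_iff_nth_less using mono[of p, OF fp] by (auto simp del: upt_Suc)
  have sQ: "sorted_wrt (<) Q"
    unfolding Q_def sorted_wrt_iff_nth_less using mono[of q, OF fq] by (auto simp del: upt_Suc)
  have S: "set [1..<n+2] = {1..n+1}"
    by (auto simp del: upt_Suc)
  have "set P = f ` {1..n+1}" "set Q = f ` {1..n+1}"
    unfolding P_def Q_def using permutes_image[OF p] permutes_image[OF q]
    by (simp_all only: set_map S image_comp[symmetric])
  then have PQ: "P = Q"
    using sP sQ by (intro strict_sorted_equal) auto
  have injf: "inj_on f {1..n+1}"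
  proof (rule eq_card_imp_inj_on)
    have "distinct P"
      using sP by (simp add: strict_sorted_iff)
    then show "card (f ` {1..n+1}) = card {1..n+1}"
      using \<open>set P = f ` {1..n+1}\<close> len distinct_card by fastforce
  qed simp
  show "p = q"
  proof
    fix i
    show "p i = q i"
    proof (cases "i \<in> {1..n+1}")
      case True
      then have "P ! (i - 1) = f (p i)" "Q ! (i - 1) = f (q i)"
        by (auto simp: P_def Q_def simp del: upt_Suc)
      with PQ have "f (p i) = f (q i)" by simp
      moreover have "p i \<in> {1..n+1}" "q i \<in> {1..n+1}"
        using True p q by (simp_all only: permutes_in_image)
      ultimately show ?thesis
        using injf by (auto dest: inj_onD)
    next
      case False
      then show ?thesis
        using p q by (simp add: permutes_not_in)
    qed
  qed
qed

lemma poincare_T_eq: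
  fixes x :: "real ^ ('n::{finite,linorder})"
  assumes "\<sigma> \<in> digits CARD('n)" "x \<in> Delta_piece \<sigma>"
  shows "poincare_T x = Some (T_branch \<sigma> x)"
proof -
  have "\<tau> = \<sigma>" if t: "\<tau> \<in> digits CARD('n)" "x \<in> Delta_piece \<tau>" for \<tau>
  proof -
    have "inv \<tau> = inv \<sigma>"
      using t assms
      by (intro strict_enumeration_unique[where f = "\<lambda>m. - pdiff x m" and n = "CARD('n)"])
         (auto simp: digits_def Delta_piece_def intro: permutes_inv)
    then show ?thesis
      using t(1) assms(1) by (metis digits_def mem_Collect_eq permutes_inv_inv)
  qed
  then have "(THE \<tau>. \<tau> \<in> digits CARD('n) \<and> x \<in> Delta_piece \<tau>) = \<sigma>"
    using assms by blast
  then show ?thesis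
    using assms by (auto simp: poincare_T_def)
qed

lemma dual_T_eq:
  fixes x :: "real ^ ('n::{finite,linorder})"
  assumes "\<sigma> \<in> digits CARD('n)" "x \<in> dual_Delta_piece \<sigma>"
  shows "dual_T x = Some (dual_T_branch \<sigma> x)"
proof -
  have "\<tau> = \<sigma>" if "\<tau> \<in> digits CARD('n)" "x \<in> dual_Delta_piece \<tau>" for \<tau>
    using that assms
    by (intro strict_enumeration_unique[where f = "\<lambda>m. crd x (m - 1)" and n = "CARD('n)"])
       (auto simp: digits_def dual_Delta_piece_def)
  then have "(THE \<tau>. \<tau> \<in> digits CARD('n) \<and> x \<in> dual_Delta_piece \<tau>) = \<sigma>"
    using assms by blast
  then show ?thesis
    using assms by (auto simp: dual_T_def)
qed

section \<open>Algebraic self-duality\<close>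

(* Bijectivity is up to a Lebesgue null set: by invariance of domain there is no continuous
   bijection from the open orthant onto the compact simplex Delta, so phi is required to map
   the orthant bijectively onto the interior of Delta, whose complement in Delta is negligible.
   The intertwining relation is an equality of partial maps: both sides have the same domain
   and agree there. *)
definition self_dual_via ::
  "(real ^ ('n::{finite,linorder}) \<Rightarrow> real ^ ('n::{finite,linorder})) \<Rightarrow> (nat \<Rightarrow> nat) set \<Rightarrow> bool" where
  "self_dual_via \<phi> D \<longleftrightarrow>
     bij_betw \<phi> dual_Delta (interior Delta) \<and>
     negligible (Delta - interior Delta :: (real ^ ('n::{finite,linorder})) set) \<and>
     \<phi> differentiable_on dual_Delta \<and>
     \<phi> \<in> restrict_space borel dual_Delta \<rightarrow>\<^sub>M restrict_space borel Delta \<and>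
     (\<forall>x\<in>dual_Delta. map_option \<phi> (dual_T x) = poincare_T (\<phi> x)) \<and>
     (\<forall>\<sigma>\<in>D. \<phi> ` interior (dual_Delta_piece \<sigma>) = interior (Delta_piece \<sigma>))"

end

theory Submission
  imports Defs
begin

text \<open>
  With \<open>S\<^sub>k = x\<^sub>0 + \<dots> + x\<^sub>k\<close> the map is \<open>\<phi>(x)\<^sub>m = S\<^bsub>n-m\<^esub> / S\<^sub>n\<close>, so the differences of
  \<open>y = \<phi>(x)\<close> are \<open>y'\<^sub>m = x\<^bsub>n+1-m\<^esub> / S\<^sub>n\<close>: up to a common positive factor they are the
  homogeneous coordinates of \<open>x\<close> in reverse order. Hence \<open>\<phi>\<close> maps the orthant bijectively onto
  the set where all differences are positive, which is the interior of the simplex, and the dual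
  piece of \<open>\<sigma>\<close> onto the interior of the piece of \<open>w\<^sub>0 \<sigma>\<^sup>-\<^sup>1 w\<^sub>0\<close>. The digits fixed by this
  involution are exactly the \<open>w\<^sub>0 \<tau>\<close> with \<open>\<tau>\<close> an involution. The numerators of the dual branch
  telescope under partial summation, which gives the intertwining relation.
\<close>

section \<open>Coordinates\<close>

lemma ix_bounds:
  fixes i :: "'n::{finite,linorder}"
  shows "1 \<le> ix i" "ix i \<le> CARD('n)"
  using bij_betw_apply[OF bij_betw_ix, of i] by auto

lemma ex_ix:
  assumes "1 \<le> m" "m \<le> CARD('n)"
  obtains i :: "'n::{finite,linorder}" where "ix i = m"
  using bij_betw_imp_surj_on[OF bij_betw_ix] assms
  by (metis atLeastAtMost_iff imageE)

lemma ix_eq_iff [simp]: "ix i = ix j \<longleftrightarrow> i = (j :: 'n::{finite,linorder})"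
  using bij_betw_imp_inj_on[OF bij_betw_ix] by (auto dest: injD)

lemma crd_0 [simp]: "crd x 0 = 1"
  by (simp add: crd_def)

lemma vec_eq_crdI:
  fixes x y :: "real ^ ('n::{finite,linorder})"
  assumes "\<And>m. 1 \<le> m \<Longrightarrow> m \<le> CARD('n) \<Longrightarrow> crd x m = crd y m"
  shows "x = y"
  using assms ix_bounds by (metis crd_ix vec_eq_iff)

text \<open>Lets sums over matrix indices be rewritten as sums over the positions 0, ..., n.\<close>

lemma bij_betw_ix0:
  "bij_betw (ix0 :: 'n::{finite,linorder} option \<Rightarrow> nat) UNIV {..CARD('n)}"
proof -
  have "inj (ix0 :: 'n option \<Rightarrow> nat)"
  proof -
    have "ix i \<noteq> 0" for i :: 'n
      using ix_bounds(1)[of i] by simp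
    then show ?thesis
      by (auto simp: inj_def ix0_def split: option.splits)
  qed
  moreover have "range (ix0 :: 'n option \<Rightarrow> nat) = {..CARD('n)}"
  proof -
    have "range (ix0 :: 'n option \<Rightarrow> nat) = insert 0 (range (ix :: 'n \<Rightarrow> nat))"
      by (simp add: UNIV_option_conv image_image ix0_def)
    then show ?thesis
      using bij_betw_imp_surj_on[OF bij_betw_ix[where 'n='n]] by auto
  qed
  ultimately show ?thesis
    by (simp add: bij_betw_def)
qed

lemma ix0_simps [simp]: "ix0 None = 0" "ix0 (Some i) = ix i"
  by (simp_all add: ix0_def)

lemma ix0_le: "ix0 (r :: 'n::{finite,linorder} option) \<le> CARD('n)"
  using bij_betw_apply[OF bij_betw_ix0, of r] by auto

lemma the_inv_ix0 [simp]:
  "the_inv (ix0 :: 'n::{finite,linorder} option \<Rightarrow> nat) (ix0 r) = r"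
  using bij_betw_imp_inj_on[OF bij_betw_ix0] by (rule the_inv_f_f)

lemma ix0_the_inv:
  "m \<le> CARD('n) \<Longrightarrow> ix0 (the_inv (ix0 :: 'n::{finite,linorder} option \<Rightarrow> nat) m) = m"
  using bij_betw_ix0[where 'n='n] by (intro f_the_inv_into_f) (auto simp: bij_betw_def)

section \<open>The matrix of partial sums\<close>

text \<open>The row at position \<open>ix0 r\<close> has ones exactly in the columns at positions up
  to n - \<open>ix0 r\<close>, so it produces an initial partial sum.\<close>

lemma A_phi_mult:
  fixes v :: "real ^ ('n::{finite,linorder}) option"
  shows "(A_phi *v v) $ r = (\<Sum>m\<le>CARD('n) - ix0 r. v $ the_inv ix0 m)"
proof -
  have "(A_phi *v v) $ r = (\<Sum>c\<in>UNIV. if ix0 r + ix0 c \<le> CARD('n) then v $ c else 0)"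
    by (auto simp: matrix_vector_mult_def A_phi_def intro: sum.cong)
  also have "\<dots> = (\<Sum>c\<in>(UNIV :: 'n option set). (\<lambda>m. if ix0 r + m \<le> CARD('n) then v $ the_inv ix0 m else 0) (ix0 c))"
    by (simp cong: if_cong)
  also have "\<dots> = (\<Sum>m\<le>CARD('n). if ix0 r + m \<le> CARD('n) then v $ the_inv ix0 m else 0)"
    by (rule sum.reindex_bij_betw[OF bij_betw_ix0])
  also have "\<dots> = (\<Sum>m\<le>CARD('n) - ix0 r. v $ the_inv ix0 m)"
    using ix0_le[of r] by (intro sum.mono_neutral_cong_right) auto
  finally show ?thesis .
qed

lemma partial_sums_zero:
  fixes f :: "nat \<Rightarrow> 'a::ab_group_add"
  assumes "\<And>k. k \<le> n \<Longrightarrow> (\<Sum>m\<le>k. f m) = 0" "k \<le> n"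
  shows "f k = 0"
  using assms(1)[OF assms(2)] assms(1)[of "k - 1"] assms(2) by (cases k) auto

text \<open>A square matrix with trivial kernel is invertible. For a kernel vector all partial sums
  vanish, hence so do its entries.\<close>

lemma invertible_A_phi:
  "invertible (A_phi :: real ^ ('n::{finite,linorder}) option ^ ('n::{finite,linorder}) option)"
proof -
  have "v = 0" if v: "A_phi *v v = 0" for v :: "real ^ 'n option"
  proof -
    have "(\<Sum>m\<le>k. v $ the_inv ix0 m) = 0" if "k \<le> CARD('n)" for k
    proof -
      \<comment> \<open>The row at position n - k is the one that computes the partial sum up to
        k.\<close>
      have "(A_phi *v v) $ the_inv ix0 (CARD('n) - k) = 0"
        using v by simp
      then show ?thesis
        using that by (simp add: A_phi_mult ix0_the_inv)
    qed
    then have "v $ the_inv ix0 k = 0" if "k \<le> CARD('n)" for k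
      using that by (rule partial_sums_zero)
    then show ?thesis
      using ix0_le by (metis the_inv_ix0 vec_eq_iff zero_index)
  qed
  then show ?thesis
    by (simp add: invertible_left_inverse matrix_left_invertible_ker)
qed

definition psum :: "real ^ ('n::{finite,linorder}) \<Rightarrow> nat \<Rightarrow> real" where
  "psum x k = (\<Sum>j\<le>k. crd x j)"

text \<open>In projective terms: \<open>h\<close> is the vector (1, x) of homogeneous coordinates,
  on which \<open>A\<close> acts linearly, and division by the entry at \<open>None\<close> returns
  to the affine chart.\<close>

lemma frac_lin_mult:
  fixes A :: "real ^ ('n::{finite,linorder}) option ^ ('n::{finite,linorder}) option" and x :: "real ^ ('n::{finite,linorder})"
  defines "h \<equiv> \<chi> c. crd x (ix0 c)"
  shows "frac_lin A x = (\<chi> i. (A *v h) $ Some i / (A *v h) $ None)"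
  by (simp add: frac_lin_def h_def matrix_vector_mult_def UNIV_option_conv sum.reindex)

lemma phi_nth:
  fixes x :: "real ^ ('n::{finite,linorder})"
  shows "frac_lin A_phi x $ i = psum x (CARD('n) - ix i) / psum x CARD('n)"
  unfolding frac_lin_mult by (simp add: A_phi_mult psum_def ix0_the_inv)

section \<open>The map on the orthant\<close>

lemma crd_pos:
  fixes x :: "real ^ ('n::{finite,linorder})"
  assumes "x \<in> dual_Delta" "m \<le> CARD('n)"
  shows "0 < crd x m"
proof (cases "m = 0")
  case False
  then obtain i :: 'n where "ix i = m"
    using assms(2) ex_ix[of m] by auto
  then show ?thesis
    using assms(1) by (auto simp: dual_Delta_def)
qed simp

lemma dual_Delta_iff:
  fixes x :: "real ^ ('n::{finite,linorder})"
  shows "x \<in> dual_Delta \<longleftrightarrow> (\<forall>m\<le>CARD('n). 0 < crd x m)"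
proof
  assume pos: "\<forall>m\<le>CARD('n). 0 < crd x m"
  have "0 < x $ i" for i
    using pos ix_bounds(2)[of i] crd_ix[of x i] by metis
  then show "x \<in> dual_Delta"
    by (simp add: dual_Delta_def)
qed (simp add: crd_pos)

lemma psum_pos:
  fixes x :: "real ^ ('n::{finite,linorder})"
  assumes "x \<in> dual_Delta" "k \<le> CARD('n)"
  shows "0 < psum x k"
  unfolding psum_def using assms by (intro sum_pos) (auto intro: crd_pos)

text \<open>At m = 0 the quotient is 1 because its denominator is positive on the orthant; this lets
  the first difference be treated like the others.\<close>

lemma crd_phi:
  fixes x :: "real ^ ('n::{finite,linorder})"
  assumes "x \<in> dual_Delta" "m \<le> CARD('n)"
  shows "crd (frac_lin A_phi x) m = psum x (CARD('n) - m) / psum x CARD('n)"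
proof (cases "m = 0")
  case True
  then show ?thesis
    using psum_pos[OF assms(1), of "CARD('n)"] by simp
next
  case False
  then obtain i :: 'n where "ix i = m"
    using assms(2) ex_ix[of m] by auto
  then show ?thesis
    by (auto simp: phi_nth)
qed

text \<open>Consecutive partial sums differ by a single coordinate. The last difference, m = n + 1,
  is the shortest sum, consisting of the coordinate 1 at position 0.\<close>

lemma pdiff_phi:
  fixes x :: "real ^ ('n::{finite,linorder})"
  assumes x: "x \<in> dual_Delta" and m: "1 \<le> m" "m \<le> CARD('n) + 1"
  shows "pdiff (frac_lin A_phi x) m = crd x (CARD('n) + 1 - m) / psum x CARD('n)"
proof (cases "m \<le> CARD('n)")
  case True
  then have "CARD('n) - (m - 1) = Suc (CARD('n) - m)" "CARD('n) + 1 - m = Suc (CARD('n) - m)"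
    using m by auto
  then show ?thesis
    using True m by (simp add: pdiff_def crd_phi[OF x] psum_def diff_divide_distrib[symmetric])
next
  case False
  then have "m = CARD('n) + 1"
    using m by simp
  then show ?thesis
    by (simp add: pdiff_def crd_phi[OF x] psum_def)
qed

section \<open>The interior of the simplex\<close>

text \<open>The n + 1 differences sum to 1 and are the barycentric coordinates of the
  simplex.\<close>

definition open_Delta :: "(real ^ ('n::{finite,linorder})) set" where
  "open_Delta = {y. \<forall>m\<in>{1..CARD('n)+1}. 0 < pdiff y m}"

lemma Delta_iff:
  fixes y :: "real ^ ('n::{finite,linorder})"
  shows "y \<in> Delta \<longleftrightarrow> (\<forall>m\<in>{1..CARD('n)+1}. 0 \<le> pdiff y m)"
proof -
  have "{1..CARD('n)+1} = insert (CARD('n)+1) {1..CARD('n)}"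
    by auto
  then show ?thesis
    by (auto simp: Delta_def pdiff_def)
qed

lemma continuous_on_crd [continuous_intros]: "continuous_on S (\<lambda>x. crd x m)"
  by (cases "m = 0") (auto simp: crd_def intro!: continuous_intros)

lemma continuous_on_pdiff [continuous_intros]: "continuous_on S (\<lambda>x. pdiff x m)"
  unfolding pdiff_def by (cases "m \<le> CARD('a)") (auto intro!: continuous_intros)

lemma open_open_Delta: "open (open_Delta :: (real ^ ('n::{finite,linorder})) set)"
proof -
  have eq: "open_Delta = (\<Inter>m\<in>{1..CARD('n)+1}. {y :: real ^ ('n::_). 0 < pdiff y m})"
    by (auto simp: open_Delta_def)
  show ?thesis
    unfolding eq by (intro open_INT finite_atLeastAtMost ballI open_Collect_less continuous_intros)
qed

lemma crd_add_axis:
  fixes y :: "real ^ ('n::{finite,linorder})"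
  assumes "m \<le> CARD('n)"
  shows "crd (y + c *\<^sub>R axis k 1) m = crd y m + (if m = ix k then c else 0)"
proof (cases "m = 0")
  case True
  then show ?thesis
    using ix_bounds(1)[of k] by auto
next
  case False
  then obtain i :: 'n where "ix i = m"
    using assms ex_ix[of m] by auto
  then show ?thesis
    by (auto simp: axis_def)
qed

text \<open>A suitable axis step of length \<open>e\<close> lowers a chosen difference by
  \<open>e\<close>. From an interior point such a step stays in the simplex, so that difference was
  at least \<open>e\<close>.\<close>

lemma interior_Delta: "interior Delta = (open_Delta :: (real ^ ('n::{finite,linorder})) set)"
proof
  have "(open_Delta :: (real ^ ('n::_)) set) \<subseteq> Delta"
    by (auto simp: open_Delta_def Delta_iff less_imp_le)
  then show "open_Delta \<subseteq> interior (Delta :: (real ^ ('n::_)) set)"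
    using open_open_Delta by (rule interior_maximal)
next
  show "interior (Delta :: (real ^ ('n::_)) set) \<subseteq> open_Delta"
  proof
    fix y :: "real ^ ('n::_)"
    assume "y \<in> interior Delta"
    then obtain e where e: "0 < e" "cball y e \<subseteq> Delta"
      by (meson mem_interior_cball)
    have nbr: "y + c *\<^sub>R axis k 1 \<in> Delta" if "\<bar>c\<bar> = e" for c and k :: 'n
      using e(2) that by (intro subsetD[OF e(2)]) (auto simp: dist_norm norm_axis_1)
    have "0 < pdiff y m" if m: "1 \<le> m" "m \<le> CARD('n) + 1" for m
    proof (cases "m \<le> CARD('n)")
      case True
      then obtain k :: 'n where k: "ix k = m"
        using m ex_ix[of m] by auto
      have "0 \<le> pdiff (y + e *\<^sub>R axis k 1) m"
        using nbr[of e k] e(1) m unfolding Delta_iff by auto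
      also have "pdiff (y + e *\<^sub>R axis k 1) m = pdiff y m - e"
        using True m k by (simp add: pdiff_def crd_add_axis)
      finally show ?thesis
        using e(1) by simp
    next
      case False
      then have m': "m = CARD('n) + 1"
        using m by simp
      obtain k :: 'n where k: "ix k = CARD('n)"
        using ex_ix[of "CARD('n)"] by (auto simp: Suc_le_eq)
      \<comment> \<open>The last difference is the last coordinate itself, so here the step must go
        downwards.\<close>
      have "0 \<le> pdiff (y + (-e) *\<^sub>R axis k 1) m"
        using nbr[of "-e" k] e(1) m unfolding Delta_iff by auto
      also have "pdiff (y + (-e) *\<^sub>R axis k 1) m = pdiff y m - e"
        unfolding m' pdiff_def by (subst crd_add_axis) (use k in auto)
      finally show ?thesis
        using e(1) by simp
    qed
    then show "y \<in> open_Delta"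
      by (simp add: open_Delta_def)
  qed
qed

text \<open>The differences are affine rather than linear: the first one involves the constant
  coordinate 1, whence the condition on the weights.\<close>

lemma pdiff_convex_comb:
  assumes "u + v = 1"
  shows "pdiff (u *\<^sub>R x + v *\<^sub>R y) m = u * pdiff x m + v * pdiff y m"
  using assms by (auto simp: pdiff_def crd_def algebra_simps)

lemma convex_Delta: "convex Delta"
  by (rule convexI) (auto simp: Delta_iff pdiff_convex_comb)

text \<open>The removed points lie in the frontier of a convex set, which is a null set.\<close>

lemma negligible_Delta_boundary: "negligible (Delta - interior Delta)"
  using negligible_convex_frontier[OF convex_Delta]
  by (rule negligible_subset) (auto simp: frontier_def closure_def)

text \<open>The differences of the image determine the homogeneous coordinates up to a factor, and
  the coordinate 1 at position 0 fixes that factor.\<close>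

lemma bij_betw_phi:
  "bij_betw (frac_lin A_phi) dual_Delta (open_Delta :: (real ^ ('n::{finite,linorder})) set)"
proof (rule bij_betw_imageI)
  show "inj_on (frac_lin A_phi) (dual_Delta :: (real ^ ('n::_)) set)"
  proof (rule inj_onI)
    fix x y :: "real ^ ('n::_)"
    assume x: "x \<in> dual_Delta" and y: "y \<in> dual_Delta" and eq: "frac_lin A_phi x = frac_lin A_phi y"
    have ratio: "crd x m / psum x CARD('n) = crd y m / psum y CARD('n)" if "m \<le> CARD('n)" for m
      using pdiff_phi[OF x, of "CARD('n) + 1 - m"] pdiff_phi[OF y, of "CARD('n) + 1 - m"] eq that
      by simp
    \<comment> \<open>At position 0 both numerators are 1, so the denominators agree.\<close>
    have "psum x CARD('n) = psum y CARD('n)"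
      using ratio[of 0] psum_pos[OF x, of "CARD('n)"] by simp
    then show "x = y"
      using ratio psum_pos[OF y, of "CARD('n)"] by (intro vec_eq_crdI) auto
  qed
next
  show "frac_lin A_phi ` dual_Delta = (open_Delta :: (real ^ ('n::_)) set)"
  proof
    show "frac_lin A_phi ` dual_Delta \<subseteq> (open_Delta :: (real ^ ('n::_)) set)"
      unfolding open_Delta_def by (auto simp: pdiff_phi intro!: divide_pos_pos crd_pos psum_pos)
  next
    show "(open_Delta :: (real ^ ('n::_)) set) \<subseteq> frac_lin A_phi ` dual_Delta"
    proof
      fix y :: "real ^ ('n::_)"
      assume "y \<in> open_Delta"
      then have pos: "0 < pdiff y m" if "1 \<le> m" "m \<le> CARD('n) + 1" for m
        using that by (auto simp: open_Delta_def)
      have last: "pdiff y (CARD('n) + 1) = crd y CARD('n)"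
        by (simp add: pdiff_def)
      then have last_pos: "0 < crd y CARD('n)"
        using pos[of "CARD('n) + 1"] by simp
      \<comment> \<open>The preimage has the reversed differences of \<open>y\<close> as homogeneous
        coordinates; dividing by the last difference makes the one at position 0 equal to 1.\<close>
      define x :: "real ^ ('n::_)" where "x = (\<chi> i. pdiff y (CARD('n) + 1 - ix i) / crd y CARD('n))"
      have crd_x: "crd x m = pdiff y (CARD('n) + 1 - m) / crd y CARD('n)" if m: "m \<le> CARD('n)" for m
      proof (cases "m = 0")
        case True
        then show ?thesis
          using last last_pos by simp
      next
        case False
        then obtain i :: 'n where "ix i = m"
          using m ex_ix[of m] by auto
        then show ?thesis
          by (auto simp: x_def)
      qed
      have x: "x \<in> dual_Delta"
        unfolding dual_Delta_iff using last_pos by (auto simp: crd_x intro!: divide_pos_pos pos)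
      \<comment> \<open>The differences telescope from the last one backwards; for k = n the value
        is 1 / \<open>crd y CARD('n)\<close>, which cancels the normalisation.\<close>
      have psum_x: "psum x k = crd y (CARD('n) - k) / crd y CARD('n)" if "k \<le> CARD('n)" for k
        using that
      proof (induction k)
        case 0
        then show ?case
          using last_pos by (simp add: psum_def)
      next
        case (Suc k)
        have "psum x (Suc k) = psum x k + crd x (Suc k)"
          by (simp add: psum_def)
        then show ?case
          using Suc by (simp add: crd_x pdiff_def diff_divide_distrib)
      qed
      have "frac_lin A_phi x = y"
        using last_pos by (intro vec_eq_crdI) (simp add: crd_phi[OF x] psum_x)
      then show "y \<in> frac_lin A_phi ` dual_Delta"
        using x by blast
    qed
  qed
qed

section \<open>Differentiability and measurability on the orthant\<close>

lemma phi_differentiable_on: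
  "frac_lin A_phi differentiable_on (dual_Delta :: (real ^ ('n::{finite,linorder})) set)"
proof -
  have crd: "(\<lambda>x. crd x m) differentiable_on (dual_Delta :: (real ^ ('n::_)) set)" for m
    by (cases "m = 0")
       (auto simp: crd_def intro!: bounded_linear_imp_differentiable_on bounded_linear_vec_nth)
  have psum: "(\<lambda>x. psum x k) differentiable_on (dual_Delta :: (real ^ ('n::_)) set)" for k
    unfolding psum_def using crd by (auto simp: differentiable_on_def)
  have "(\<lambda>x. frac_lin A_phi x \<bullet> b) differentiable_on (dual_Delta :: (real ^ ('n::_)) set)"
    if "b \<in> Basis" for b
  proof -
    obtain i where "b = axis i 1"
      using \<open>b \<in> Basis\<close> by (auto simp: Basis_vec_def)
    moreover have "psum x CARD('n) \<noteq> 0" if "x \<in> dual_Delta" for x :: "real ^ ('n::_)"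
      using psum_pos[OF that, of "CARD('n)"] by simp
    ultimately show ?thesis
      using psum by (auto simp: inner_axis phi_nth differentiable_on_def intro!: differentiable_divide)
  qed
  then show ?thesis
    unfolding differentiable_on_def by (subst differentiable_componentwise_within) auto
qed

lemma phi_measurable:
  "frac_lin A_phi \<in> restrict_space borel (dual_Delta :: (real ^ ('n::{finite,linorder})) set)
     \<rightarrow>\<^sub>M restrict_space borel Delta"
proof (rule measurable_restrict_space2)
  show "frac_lin A_phi \<in> space (restrict_space borel (dual_Delta :: (real ^ ('n::_)) set)) \<rightarrow> Delta"
    using bij_betw_apply[OF bij_betw_phi[where 'n='n]] interior_Delta interior_subset[of Delta]
    by (auto simp: space_restrict_space)
  show "frac_lin A_phi \<in> restrict_space borel (dual_Delta :: (real ^ ('n::_)) set) \<rightarrow>\<^sub>M borel"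
    by (intro borel_measurable_continuous_on_restrict differentiable_imp_continuous_on
          phi_differentiable_on)
qed

section \<open>Pieces and branches\<close>

text \<open>The digit of the image of a point with dual digit \<open>\<sigma>\<close>: the map
  reverses coordinate positions, and the two algorithms sort in opposite directions, which accounts
  for the two factors \<open>w0\<close>.\<close>

definition dual_digit :: "nat \<Rightarrow> (nat \<Rightarrow> nat) \<Rightarrow> nat \<Rightarrow> nat" where
  "dual_digit n \<sigma> = w0 n \<circ> inv \<sigma> \<circ> w0 n"

lemma w0_w0 [simp]: "w0 n (w0 n i) = i"
  by (auto simp: w0_def)

lemma w0_digits: "w0 n \<in> digits n"
  unfolding digits_def
  by (auto simp: w0_def intro!: bij_imp_permutes bij_betwI[where g = "w0 n"])

lemma dual_digit_digits: "\<sigma> \<in> digits n \<Longrightarrow> dual_digit n \<sigma> \<in> digits n"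
  using w0_digits[of n] unfolding digits_def dual_digit_def
  by (auto intro!: permutes_compose permutes_inv)

lemma inv_dual_digit:
  assumes "\<sigma> \<in> digits n"
  shows "inv (dual_digit n \<sigma>) = w0 n \<circ> \<sigma> \<circ> w0 n"
proof (rule inv_unique_comp)
  have "\<sigma> (inv \<sigma> k) = k" "inv \<sigma> (\<sigma> k) = k" for k
    using assms by (auto simp: digits_def permutes_inverses)
  then show "dual_digit n \<sigma> \<circ> (w0 n \<circ> \<sigma> \<circ> w0 n) = id" "w0 n \<circ> \<sigma> \<circ> w0 n \<circ> dual_digit n \<sigma> = id"
    by (simp_all add: dual_digit_def fun_eq_iff)
qed

text \<open>Inversion and conjugation by \<open>w0\<close> commute and are both involutive. Hence
  every digit arises as a dual digit.\<close>

lemma dual_digit_dual_digit: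
  assumes "\<sigma> \<in> digits n"
  shows "dual_digit n (dual_digit n \<sigma>) = \<sigma>"
  by (simp add: dual_digit_def[of n "dual_digit n \<sigma>"] inv_dual_digit[OF assms] fun_eq_iff)

lemma dual_digit_w0_involution:
  assumes "\<tau> \<in> Inv_digits n"
  shows "w0 n \<circ> \<tau> \<in> digits n" "dual_digit n (w0 n \<circ> \<tau>) = w0 n \<circ> \<tau>"
proof -
  have \<tau>: "\<tau> permutes {1..n+1}" "\<tau> \<circ> \<tau> = id"
    using assms by (auto simp: Inv_digits_def digits_def)
  show "w0 n \<circ> \<tau> \<in> digits n"
    using w0_digits[of n] \<tau>(1) by (auto simp: digits_def intro: permutes_compose)
  have "\<tau> (\<tau> k) = k" for k
    using \<tau>(2) by (metis comp_apply id_apply)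
  then have "inv (w0 n \<circ> \<tau>) = \<tau> \<circ> w0 n"
    by (intro inv_unique_comp) (simp_all add: fun_eq_iff)
  then show "dual_digit n (w0 n \<circ> \<tau>) = w0 n \<circ> \<tau>"
    by (simp add: dual_digit_def fun_eq_iff)
qed

text \<open>The inverse of the dual digit is \<open>w0 n \<circ> \<sigma> \<circ> w0 n\<close>. Its
  outer reversal cancels against the one in \<open>pdiff_phi\<close>, leaving only a shift by
  one.\<close>

lemma pdiff_phi_inv_dual_digit:
  fixes x :: "real ^ ('n::{finite,linorder})"
  assumes x: "x \<in> dual_Delta" and \<sigma>: "\<sigma> \<in> digits CARD('n)" and i: "1 \<le> i" "i \<le> CARD('n) + 1"
  shows "pdiff (frac_lin A_phi x) (inv (dual_digit CARD('n) \<sigma>) i)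
           = crd x (\<sigma> (CARD('n) + 2 - i) - 1) / psum x CARD('n)"
proof -
  have "w0 CARD('n) i \<in> {1..CARD('n)+1}"
    using i by (auto simp: w0_def)
  then have "\<sigma> (w0 CARD('n) i) \<in> {1..CARD('n)+1}"
    using \<sigma> by (simp only: digits_def mem_Collect_eq permutes_in_image)
  moreover have "w0 CARD('n) i = CARD('n) + 2 - i"
    using i by (simp add: w0_def)
  ultimately have *: "\<sigma> (CARD('n) + 2 - i) \<in> {1..CARD('n)+1}"
    and inv: "inv (dual_digit CARD('n) \<sigma>) i = CARD('n) + 2 - \<sigma> (CARD('n) + 2 - i)"
    by (simp_all add: inv_dual_digit[OF \<sigma>] w0_def)
  have "CARD('n) + 1 - (CARD('n) + 2 - \<sigma> (CARD('n) + 2 - i)) = \<sigma> (CARD('n) + 2 - i) - 1"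
    using * by auto
  then show ?thesis
    using * unfolding inv by (subst pdiff_phi[OF x]) auto
qed

lemma phi_in_Delta_piece_iff:
  fixes x :: "real ^ ('n::{finite,linorder})"
  assumes x: "x \<in> dual_Delta" and \<sigma>: "\<sigma> \<in> digits CARD('n)"
  shows "frac_lin A_phi x \<in> Delta_piece (dual_digit CARD('n) \<sigma>) \<longleftrightarrow> x \<in> dual_Delta_piece \<sigma>"
proof -
  let ?n = "CARD('n)"
  let ?f = "\<lambda>k. crd x (\<sigma> k - 1)"
  have "frac_lin A_phi x \<in> Delta"
    using bij_betw_apply[OF bij_betw_phi x] interior_Delta interior_subset[of Delta] by auto
  moreover have "pdiff (frac_lin A_phi x) (inv (dual_digit ?n \<sigma>) i)
                   > pdiff (frac_lin A_phi x) (inv (dual_digit ?n \<sigma>) (i + 1))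
                 \<longleftrightarrow> ?f (?n + 1 - i) < ?f (?n + 1 - i + 1)" if "i \<in> {1..?n}" for i
  proof -
    have "?n + 2 - (i + 1) = ?n + 1 - i" "?n + 2 - i = ?n + 1 - i + 1"
      using that by auto
    then show ?thesis
      using that psum_pos[OF x, of ?n]
      by (simp add: pdiff_phi_inv_dual_digit[OF x \<sigma>] divide_less_cancel)
  qed
  ultimately have "frac_lin A_phi x \<in> Delta_piece (dual_digit ?n \<sigma>)
      \<longleftrightarrow> (\<forall>i\<in>{1..?n}. ?f (?n + 1 - i) < ?f (?n + 1 - i + 1))"
    by (simp add: Delta_piece_def)
  \<comment> \<open>The reflection of 1, ..., n turns the decreasing chain of differences into the
    increasing chain of coordinates.\<close>
  also have "\<dots> \<longleftrightarrow> (\<forall>i\<in>(\<lambda>i. ?n + 1 - i) ` {1..?n}. ?f i < ?f (i + 1))"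
    by blast
  also have "(\<lambda>i. ?n + 1 - i) ` {1..?n} = {1..?n}"
    by (rule bij_betw_imp_surj_on, rule bij_betwI[where g = "\<lambda>i. ?n + 1 - i"]) auto
  finally show ?thesis
    using x by (simp add: dual_Delta_piece_def)
qed

section \<open>Interiors of the pieces and their images\<close>

lemma open_dual_Delta: "open (dual_Delta :: (real ^ ('n::{finite,linorder})) set)"
proof -
  have eq: "dual_Delta = (\<Inter>i. {x :: real ^ ('n::_). 0 < x $ i})"
    by (auto simp: dual_Delta_def)
  show ?thesis
    unfolding eq by (intro open_INT finite ballI open_Collect_less continuous_intros)
qed

lemma open_dual_Delta_piece:
  "open (dual_Delta_piece \<sigma> :: (real ^ ('n::{finite,linorder})) set)"
proof -
  have "dual_Delta_piece \<sigma> = dual_Delta \<inter>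
      (\<Inter>i\<in>{1..CARD('n)}. {x :: real ^ ('n::_). 0 < crd x (\<sigma> (i + 1) - 1) - crd x (\<sigma> i - 1)})"
    by (auto simp: dual_Delta_piece_def)
  then show ?thesis
    by (auto intro!: open_Int open_dual_Delta open_INT open_Collect_less continuous_intros)
qed

text \<open>A piece may contain boundary points of the simplex, where its smallest difference is 0.
  Within the open simplex it is cut out by strict inequalities between continuous functions.\<close>

lemma interior_Delta_piece:
  "interior (Delta_piece \<sigma>) = open_Delta \<inter> (Delta_piece \<sigma> :: (real ^ ('n::{finite,linorder})) set)"
proof
  have "interior (Delta_piece \<sigma>) \<subseteq> interior (Delta :: (real ^ ('n::_)) set)"
    by (rule interior_mono) (auto simp: Delta_piece_def)
  then show "interior (Delta_piece \<sigma>) \<subseteq> open_Delta \<inter> (Delta_piece \<sigma> :: (real ^ ('n::_)) set)"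
    using interior_subset by (auto simp: interior_Delta)
next
  have "open_Delta \<inter> Delta_piece \<sigma> = open_Delta \<inter>
      (\<Inter>i\<in>{1..CARD('n)}. {y :: real ^ ('n::_). pdiff y (inv \<sigma> (i + 1)) < pdiff y (inv \<sigma> i)})"
    using interior_Delta[where 'n='n] interior_subset[of "Delta :: (real ^ ('n::_)) set"]
    by (auto simp: Delta_piece_def)
  then have "open (open_Delta \<inter> (Delta_piece \<sigma> :: (real ^ ('n::_)) set))"
    by (auto intro!: open_Int open_open_Delta open_INT open_Collect_less continuous_intros)
  then show "open_Delta \<inter> (Delta_piece \<sigma> :: (real ^ ('n::_)) set) \<subseteq> interior (Delta_piece \<sigma>)"
    by (intro interior_maximal) auto
qed

text \<open>Within the orthant the dual piece is the preimage of the piece of the dual digit, and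
  the image of the whole orthant is the open simplex.\<close>

lemma phi_image_dual_Delta_piece:
  assumes \<sigma>: "\<sigma> \<in> digits CARD('n)"
  shows "frac_lin A_phi ` interior (dual_Delta_piece \<sigma>)
           = interior (Delta_piece (dual_digit CARD('n) \<sigma>) :: (real ^ ('n::{finite,linorder})) set)"
proof -
  have "frac_lin A_phi ` (dual_Delta_piece \<sigma> :: (real ^ ('n::_)) set)
          = frac_lin A_phi ` {x \<in> dual_Delta. frac_lin A_phi x \<in> Delta_piece (dual_digit CARD('n) \<sigma>)}"
    using phi_in_Delta_piece_iff[OF _ \<sigma>] by (auto simp: dual_Delta_piece_def)
  also have "\<dots> = (frac_lin A_phi ` dual_Delta) \<inter> Delta_piece (dual_digit CARD('n) \<sigma>)"
    by blast
  finally show ?thesis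
    using bij_betw_imp_surj_on[OF bij_betw_phi[where 'n='n]]
    by (simp add: interior_open open_dual_Delta_piece interior_Delta_piece)
qed

section \<open>The intertwining relation\<close>

lemma phi_dual_T_branch:
  fixes x :: "real ^ ('n::{finite,linorder})"
  assumes x: "x \<in> dual_Delta_piece \<sigma>" and \<sigma>: "\<sigma> \<in> digits CARD('n)"
  shows "frac_lin A_phi (dual_T_branch \<sigma> x) = T_branch (dual_digit CARD('n) \<sigma>) (frac_lin A_phi x)"
proof -
  let ?n = "CARD('n)"
  let ?f = "\<lambda>k. crd x (\<sigma> k - 1)"
  have x': "x \<in> dual_Delta"
    using x by (simp add: dual_Delta_piece_def)
  have f_pos: "0 < ?f k" if "1 \<le> k" "k \<le> ?n + 1" for k
  proof -
    have "\<sigma> k \<in> {1..?n+1}"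
      using \<sigma> that by (simp only: digits_def mem_Collect_eq permutes_in_image) simp
    then show ?thesis
      by (intro crd_pos[OF x']) auto
  qed
  \<comment> \<open>The coordinate 1 at position 0 is \<open>?f 1 / ?f 1\<close> and starts the
    telescoping sum.\<close>
  have psum_branch: "psum (dual_T_branch \<sigma> x) k = ?f (k + 1) / ?f 1" if "k \<le> ?n" for k
    using that
  proof (induction k)
    case 0
    then show ?case
      using f_pos[of 1] by (simp add: psum_def)
  next
    case (Suc k)
    then obtain i :: 'n where i: "ix i = Suc k"
      using ex_ix[of "Suc k"] by auto
    have "crd (dual_T_branch \<sigma> x) (Suc k) = (?f (Suc k + 1) - ?f (Suc k)) / ?f 1"
      using i by (metis (no_types, lifting) crd_ix dual_T_branch_def vec_lambda_beta)
    moreover have "psum (dual_T_branch \<sigma> x) (Suc k)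
        = psum (dual_T_branch \<sigma> x) k + crd (dual_T_branch \<sigma> x) (Suc k)"
      by (simp add: psum_def)
    ultimately show ?case
      using Suc by (simp add: diff_divide_distrib)
  qed
  have "frac_lin A_phi (dual_T_branch \<sigma> x) $ i
          = T_branch (dual_digit ?n \<sigma>) (frac_lin A_phi x) $ i" for i
  proof -
    have i: "1 \<le> ix i" "ix i \<le> ?n"
      by (rule ix_bounds)+
    have "frac_lin A_phi (dual_T_branch \<sigma> x) $ i = ?f (?n - ix i + 1) / ?f (?n + 1)"
      using i f_pos[of 1] by (simp add: phi_nth psum_branch)
    also have "\<dots> = T_branch (dual_digit ?n \<sigma>) (frac_lin A_phi x) $ i"
    proof -
      \<comment> \<open>Coordinate i of the branch compares the difference of rank i + 1 with the
        largest one, of rank 1; the factor \<open>psum x CARD('n)\<close> cancels.\<close>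
      have "?n + 2 - (ix i + 1) = ?n - ix i + 1" "?n + 2 - 1 = ?n + 1"
        using i by auto
      then show ?thesis
        using i psum_pos[OF x', of ?n]
        by (simp add: T_branch_def pdiff_phi_inv_dual_digit[OF x' \<sigma>])
    qed
    finally show ?thesis .
  qed
  then show ?thesis
    by (simp add: vec_eq_iff)
qed

lemma phi_intertwines:
  fixes x :: "real ^ ('n::{finite,linorder})"
  assumes x: "x \<in> dual_Delta"
  shows "map_option (frac_lin A_phi) (dual_T x) = poincare_T (frac_lin A_phi x)"
proof (cases "\<exists>\<sigma>\<in>digits CARD('n). x \<in> dual_Delta_piece \<sigma>")
  case True
  then obtain \<sigma> where \<sigma>: "\<sigma> \<in> digits CARD('n)" "x \<in> dual_Delta_piece \<sigma>"
    by blast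
  then have "poincare_T (frac_lin A_phi x)
      = Some (T_branch (dual_digit CARD('n) \<sigma>) (frac_lin A_phi x))"
    by (intro poincare_T_eq) (simp_all add: dual_digit_digits phi_in_Delta_piece_iff[OF x])
  then show ?thesis
    using \<sigma> by (simp add: dual_T_eq phi_dual_T_branch)
next
  case False
  \<comment> \<open>Equality of partial maps also needs equal domains: a digit
    \<open>\<sigma>\<close> of the image would make \<open>dual_digit CARD('n) \<sigma>\<close> a
    digit of \<open>x\<close>.\<close>
  have "frac_lin A_phi x \<notin> Delta_piece \<sigma>" if "\<sigma> \<in> digits CARD('n)" for \<sigma>
    using False phi_in_Delta_piece_iff[OF x dual_digit_digits[OF that]] dual_digit_digits[OF that]
    by (auto simp: dual_digit_dual_digit[OF that])
  then show ?thesis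
    using False by (simp add: dual_T_def poincare_T_def)
qed

theorem theorem3:
  shows "invertible (A_phi :: real ^ ('n::{finite,linorder}) option ^ ('n::{finite,linorder}) option) \<and>
    self_dual_via (frac_lin A_phi :: real ^ ('n::{finite,linorder}) \<Rightarrow> real ^ ('n::{finite,linorder}))
      {w0 CARD('n) \<circ> \<tau> | \<tau>. \<tau> \<in> Inv_digits CARD('n)}"
  unfolding self_dual_via_def
proof (intro conjI ballI)
  fix \<sigma>
  assume "\<sigma> \<in> {w0 CARD('n) \<circ> \<tau> | \<tau>. \<tau> \<in> Inv_digits CARD('n)}"
  \<comment> \<open>Only at this point is the special set of digits used: on it the image piece
    carries the same digit.\<close>
  then have "\<sigma> \<in> digits CARD('n)" "dual_digit CARD('n) \<sigma> = \<sigma>"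
    using dual_digit_w0_involution by auto
  then show "frac_lin A_phi ` interior (dual_Delta_piece \<sigma> :: (real ^ ('n::_)) set)
      = interior (Delta_piece \<sigma>)"
    using phi_image_dual_Delta_piece[where 'n='n, of \<sigma>] by simp
qed (simp_all add: invertible_A_phi interior_Delta bij_betw_phi phi_differentiable_on
      phi_measurable phi_intertwines negligible_Delta_boundary[unfolded interior_Delta])

end
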